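(* Let $S$ be a countably based $\mathrm{Cu}$-semigroup satisfying (O7). Then for each $x\in S$ and each idempotent element $w\in S$ (that is, $2w=w$), the infimum $x\wedge w$ exists in $S$.
   Context: A positively ordered monoid is a commutative monoid with a partial order compatible with addition such that $0\leq x$ for all $x$. In an ordered set where increasing sequences have suprema, $x\ll y$ means: whenever $(y_n)_n$ is increasing with $y\leq\sup_n y_n$, there is $n_0$ with $x\leq y_{n_0}$. A $\mathrm{Cu}$-semigroup is a positively ordered monoid $S$ such that: (O1) every increasing sequence has a supremum; (O2) every $x\in S$ is the supremum of some $\ll$-increasing sequence; (O3) $x_1\ll y_1$ and $x_2\ll y_2$ imply $x_1+x_2\ll y_1+y_2$; (O4) $\sup_n(x_n+y_n)=\sup_n x_n+\sup_n y_n$ for increasing sequences $(x_n)_n,(y_n)_n$. (O7): whenever $x_1'\ll x_1\leq w$ and $x_2'\ll x_2\leq w$ in $S$, there exists $x\in S$ with $x_1',x_2'\ll x$ and $x\leq w$, $x\leq x_1+x_2$. $S$ is countably based if it contains a countable subset $B$ such that every element of $S$ is the supremum of a $\ll$-increasing sequence with terms in $B$. *)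

theory Defs
  imports "HOL-Library.Countable_Set" "HOL-Library.Lub_Glb"
begin

text \<open>
  Suprema and infima are taken in the whole ordered set: \<open>isLub UNIV A s\<close> says that \<open>s\<close> is
  the supremum of \<open>A\<close>, and \<open>isGlb UNIV A i\<close> that \<open>i\<close> is its infimum.

  Increasing sequences (\<open>incseq\<close>) are not required to be strictly increasing.
\<close>

text \<open>
  The supremum of the sequence \<open>Y\<close> is the variable \<open>s\<close>: an order has no supremum operation.
  Where increasing sequences have suprema, this is the usual sequential way-below relation.
\<close>

definition way_below :: "'a::order \<Rightarrow> 'a \<Rightarrow> bool"  (infix "\<lless>" 50)
  where "x \<lless> y \<longleftrightarrow>
    (\<forall>Y s. incseq Y \<longrightarrow> isLub UNIV (range Y) s \<longrightarrow> y \<le> s \<longrightarrow> (\<exists>n0. x \<le> Y n0))"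

definition way_below_incseq :: "(nat \<Rightarrow> 'a::order) \<Rightarrow> bool"
  where "way_below_incseq X \<longleftrightarrow> (\<forall>n. X n \<lless> X (Suc n))"

text \<open>
  The order is only assumed compatible with addition and nonnegative; it need not be the
  algebraic order, as it would be in class \<open>canonically_ordered_monoid_add\<close>.
\<close>

class positively_ordered_monoid = ordered_comm_monoid_add +
  assumes zero_least: "0 \<le> x"

text \<open>
  The structures are types, so a property of the whole semigroup \<open>'a\<close> is a predicate on
  \<open>TYPE('a)\<close>.
\<close>

definition O1 :: "'a::positively_ordered_monoid itself \<Rightarrow> bool"
  where "O1 _ \<longleftrightarrow> (\<forall>X::nat \<Rightarrow> 'a. incseq X \<longrightarrow> (\<exists>s. isLub UNIV (range X) s))"

definition O2 :: "'a::positively_ordered_monoid itself \<Rightarrow> bool"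
  where "O2 _ \<longleftrightarrow> (\<forall>x::'a. \<exists>X. way_below_incseq X \<and> isLub UNIV (range X) x)"

definition O3 :: "'a::positively_ordered_monoid itself \<Rightarrow> bool"
  where "O3 _ \<longleftrightarrow>
    (\<forall>x1 y1 x2 y2::'a. x1 \<lless> y1 \<longrightarrow> x2 \<lless> y2 \<longrightarrow> x1 + x2 \<lless> y1 + y2)"

definition O4 :: "'a::positively_ordered_monoid itself \<Rightarrow> bool"
  where "O4 _ \<longleftrightarrow>
    (\<forall>(X::nat \<Rightarrow> 'a) Y s t. incseq X \<longrightarrow> incseq Y \<longrightarrow>
      isLub UNIV (range X) s \<longrightarrow> isLub UNIV (range Y) t \<longrightarrow>
      isLub UNIV (range (\<lambda>n. X n + Y n)) (s + t))"

definition Cu_semigroup :: "'a::positively_ordered_monoid itself \<Rightarrow> bool"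
  where "Cu_semigroup S \<longleftrightarrow> O1 S \<and> O2 S \<and> O3 S \<and> O4 S"

definition O7 :: "'a::positively_ordered_monoid itself \<Rightarrow> bool"
  where "O7 _ \<longleftrightarrow>
    (\<forall>x1' x1 x2' x2 w::'a. x1' \<lless> x1 \<longrightarrow> x1 \<le> w \<longrightarrow> x2' \<lless> x2 \<longrightarrow> x2 \<le> w \<longrightarrow>
      (\<exists>x. x1' \<lless> x \<and> x2' \<lless> x \<and> x \<le> w \<and> x \<le> x1 + x2))"

definition countably_based :: "'a::positively_ordered_monoid itself \<Rightarrow> bool"
  where "countably_based _ \<longleftrightarrow>
    (\<exists>B::'a set. countable B \<and>
      (\<forall>x. \<exists>X. way_below_incseq X \<and> range X \<subseteq> B \<and> isLub UNIV (range X) x))"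

end

theory Submission
  imports Defs
begin

text \<open>
  Let \<open>L\<close> be the set of lower bounds of \<open>{x, w}\<close>. If \<open>a \<lless> y\<close> and \<open>b \<lless> z\<close> with \<open>y, z \<in> L\<close>,
  then (O7) below \<open>x\<close> gives \<open>u \<le> x\<close> with \<open>a, b \<lless> u\<close> and \<open>u \<le> y + z \<le> w + w = w\<close>, so \<open>u \<in> L\<close>.
  Hence the basis elements way below some member of \<open>L\<close> form a countable directed set. Its
  supremum is below \<open>x\<close> and \<open>w\<close>, and above every member of \<open>L\<close>.
\<close>

text \<open>This form shows that a supremum depends only on the upper bounds of \<open>A\<close>, so
  sets with the same upper bounds have the same suprema.\<close>

lemma isLub_UNIV_iff: "isLub UNIV A (s::'a::order) \<longleftrightarrow> (\<forall>u. s \<le> u \<longleftrightarrow> (\<forall>a\<in>A. a \<le> u))"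
  unfolding isLub_def isUb_def leastP_def setle_def setge_def
  by simp (meson order_refl order_trans)

lemma isGlb_UNIV_iff: "isGlb UNIV A (s::'a::order) \<longleftrightarrow> (\<forall>u. u \<le> s \<longleftrightarrow> (\<forall>a\<in>A. u \<le> a))"
  unfolding isGlb_def isLb_def greatestP_def setle_def setge_def
  by simp (meson order_refl order_trans)

lemma way_below_imp_le: "x \<le> y" if "x \<lless> y" for x y :: "'a::order"
proof -
  have "incseq (\<lambda>_::nat. y)" "isLub UNIV (range (\<lambda>_::nat. y)) y"
    by (auto simp: isLub_UNIV_iff)
  with that show ?thesis
    unfolding way_below_def by blast
qed

lemma way_below_le_trans: "x \<lless> y \<Longrightarrow> y \<le> z \<Longrightarrow> x \<lless> z"
  unfolding way_below_def by (meson order_trans)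

lemma way_below_incseq_imp_incseq: "way_below_incseq X \<Longrightarrow> incseq X"
  by (simp add: incseq_SucI way_below_imp_le way_below_incseq_def)

lemma way_below_incseq_way_below_isLub:
  assumes "way_below_incseq X" and "isLub UNIV (range X) s"
  shows "X n \<lless> s"
proof (rule way_below_le_trans)
  show "X n \<lless> X (Suc n)"
    using assms(1) by (simp add: way_below_incseq_def)
  show "X (Suc n) \<le> s"
    using assms(2) by (auto simp: isLub_UNIV_iff)
qed

text \<open>(O1) only provides suprema of increasing sequences. Directedness turns an enumeration of
  \<open>D\<close> into an increasing sequence in \<open>D\<close> that is cofinal in
  \<open>D\<close>.\<close>

lemma countable_directed_isLub:
  fixes D :: "'a::positively_ordered_monoid set"
  assumes "O1 TYPE('a)" and "countable D" and "D \<noteq> {}"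
    and directed: "\<And>a b. a \<in> D \<Longrightarrow> b \<in> D \<Longrightarrow> \<exists>c\<in>D. a \<le> c \<and> b \<le> c"
  shows "\<exists>s. isLub UNIV D s"
proof -
  define f where "f = from_nat_into D"
  have f: "range f = D"
    using assms(2,3) by (simp add: f_def range_from_nat_into)
  have "\<exists>c. c \<in> D" "\<And>c n. c \<in> D \<Longrightarrow> \<exists>d. d \<in> D \<and> c \<le> d \<and> f n \<le> d"
    using directed f \<open>D \<noteq> {}\<close> by blast+
  \<comment> \<open>Recursively, \<open>g (Suc n)\<close> is chosen in \<open>D\<close> above both
    \<open>g n\<close> and the \<open>n\<close>-th enumerated element \<open>f n\<close>.\<close>
  then obtain g where g: "\<And>n. g n \<in> D" "\<And>n. g n \<le> g (Suc n) \<and> f n \<le> g (Suc n)"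
    using dependent_nat_choice[of "\<lambda>_ c. c \<in> D" "\<lambda>n c d. c \<le> d \<and> f n \<le> d"] by auto
  have "incseq g"
    using g(2) by (auto intro: incseq_SucI)
  then obtain s where "isLub UNIV (range g) s"
    using assms(1) unfolding O1_def by blast
  moreover have "(\<forall>a\<in>range g. a \<le> u) \<longleftrightarrow> (\<forall>a\<in>D. a \<le> u)" for u
  proof
    assume "\<forall>a\<in>range g. a \<le> u"
    then have "f n \<le> u" for n
      using g(2)[of n] by (blast intro: order_trans)
    then show "\<forall>a\<in>D. a \<le> u"
      using f by blast
  next
    assume "\<forall>a\<in>D. a \<le> u"
    then show "\<forall>a\<in>range g. a \<le> u"
      using g(1) by blast
  qed
  ultimately show ?thesis
    unfolding isLub_UNIV_iff by blast
qed

theorem theorem2p4: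
  fixes x w :: "'a::positively_ordered_monoid"
  assumes "Cu_semigroup TYPE('a)"
    and "countably_based TYPE('a)"
    and "O7 TYPE('a)"
    and "w + w = w"
  shows "\<exists>z. isGlb UNIV {x, w} z"
proof -
  obtain B :: "'a set" where "countable B"
    and B: "\<And>z. \<exists>X. way_below_incseq X \<and> range X \<subseteq> B \<and> isLub UNIV (range X) z"
    using assms(2) unfolding countably_based_def by blast
  define D where "D = {d \<in> B. \<exists>z. d \<lless> z \<and> z \<le> x \<and> z \<le> w}"
  \<comment> \<open>The terms of a basis sequence with supremum \<open>z\<close> are way below
    \<open>z\<close>, so \<open>z\<close> itself witnesses their membership in
    \<open>D\<close>.\<close>
  have approx: "\<exists>X. incseq X \<and> range X \<subseteq> D \<and> isLub UNIV (range X) z"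
    if "z \<le> x" "z \<le> w" for z
  proof -
    obtain X where X: "way_below_incseq X" "range X \<subseteq> B" "isLub UNIV (range X) z"
      using B by blast
    then have "range X \<subseteq> D"
      using that way_below_incseq_way_below_isLub[OF X(1,3)] by (auto simp: D_def)
    with X show ?thesis
      using way_below_incseq_imp_incseq by blast
  qed
  have "\<exists>s. isLub UNIV D s"
  proof (rule countable_directed_isLub)
    show "O1 TYPE('a)"
      using assms(1) by (simp add: Cu_semigroup_def)
    show "countable D"
      using \<open>countable B\<close> by (rule countable_subset[rotated]) (auto simp: D_def)
    \<comment> \<open>Since \<open>0\<close> is a lower bound of \<open>x\<close> and
      \<open>w\<close>, its approximating sequence lies in \<open>D\<close>.\<close>
    show "D \<noteq> {}"
      using approx[of 0] zero_least by blast
  next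
    fix a b assume "a \<in> D" "b \<in> D"
    then obtain y z where "a \<lless> y" "y \<le> x" "y \<le> w" "b \<lless> z" "z \<le> x" "z \<le> w"
      by (auto simp: D_def)
    \<comment> \<open>(O7) is applied with \<open>x\<close> as the common upper bound; the bound by
      \<open>w\<close> has to come from \<open>y + z\<close>.\<close>
    then obtain u where u: "a \<lless> u" "b \<lless> u" "u \<le> x" "u \<le> y + z"
      using assms(3) unfolding O7_def by blast
    have "y + z \<le> w"
      using add_mono[OF \<open>y \<le> w\<close> \<open>z \<le> w\<close>] assms(4) by simp
    with u(4) have "u \<le> w"
      by (rule order_trans)
    \<comment> \<open>\<open>u\<close> need not lie in \<open>B\<close>. As \<open>a\<close> and
      \<open>b\<close> are way below \<open>u\<close>, a late enough term of a sequence in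
      \<open>D\<close> with supremum \<open>u\<close> dominates both.\<close>
    then obtain X where X: "incseq X" "range X \<subseteq> D" "isLub UNIV (range X) u"
      using approx u(3) by blast
    obtain m n where "a \<le> X m" "b \<le> X n"
      using u(1,2) X(1,3) unfolding way_below_def by blast
    then have "a \<le> X (max m n)" "b \<le> X (max m n)"
      using incseqD[OF X(1)] by (meson max.cobounded1 max.cobounded2 order_trans)+
    then show "\<exists>c\<in>D. a \<le> c \<and> b \<le> c"
      using X(2) by blast
  qed
  then obtain s where s: "\<And>u. s \<le> u \<longleftrightarrow> (\<forall>d\<in>D. d \<le> u)"
    by (auto simp: isLub_UNIV_iff)
  have "d \<le> x \<and> d \<le> w" if "d \<in> D" for d
    using that unfolding D_def by (blast dest: way_below_imp_le intro: order_trans)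
  then have "s \<le> x" "s \<le> w"
    using s by blast+
  \<comment> \<open>\<open>z\<close> need not lie in \<open>D\<close>, but it is a supremum of
    elements of \<open>D\<close>, all of which are below \<open>s\<close>.\<close>
  moreover have "z \<le> s" if lower: "z \<le> x" "z \<le> w" for z
  proof -
    obtain X :: "nat \<Rightarrow> 'a" where X: "range X \<subseteq> D" "isLub UNIV (range X) z"
      using approx[OF lower] by blast
    have "\<forall>d\<in>D. d \<le> s"
      using s by blast
    with X show ?thesis
      by (auto simp: isLub_UNIV_iff)
  qed
  ultimately show ?thesis
    unfolding isGlb_UNIV_iff by simp (meson order_trans)
qed

end
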